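(* Let $G$ be a connected graph with cut decomposition $(X,\mathcal{C})$, and let $x$ be a node of $X$. Suppose that the survivor is restricted to the vertices of $G[\Lambda_X(x)]$, i.e. its position is always in $\bigcup_{y\in\Lambda_X(x)} C_y$. Then $\mathrm{load}(x)$ lazy zombies, starting from any vertices of $G$, can capture the survivor in at most $\mathrm{time}(x)$ rounds.
   Context: Lazy zombies and survivor game on a connected graph $G$: each round, first every lazy zombie either stays at its current vertex $u$ or moves to a neighbour of $u$ lying on a shortest path in $G$ from $u$ to the survivor's current vertex; then the survivor stays or moves to an adjacent vertex; full information; capture means a lazy zombie occupies the survivor's vertex. $\delta(G)$ denotes the diameter of $G$. A cut decomposition of $G$ is a pair $(X,\mathcal{C})$ where $X$ is a rooted tree and $\mathcal{C}=\{C_x\subseteq V(G): x\in V(X)\}$ such that: every $v\in V(G)$ lies in $C_x$ for a unique $x$; for every edge $uv$ of $G$ there are $x,y$ with $u\in C_x$, $v\in C_y$ and $x$ an ancestor of $y$ (a node is its own ancestor); for every non-leaf node $y$, $C_y$ is a cut set of the induced subgraph $G[\Lambda_X(y)] := G[\bigcup_{x\in\Lambda_X(y)} C_x]$, where $\Lambda_X(y)$ is the subtree of $X$ rooted at $y$. Define $\mathrm{load}(x)=|C_x|$ if $x$ is a leaf and $\mathrm{load}(x)=|C_x|+\max_y \mathrm{load}(y)$ otherwise ($y$ ranging over children of $x$); $\mathrm{time}(x)=|C_x|(\delta(G)-1)+1$ if $x$ is a leaf and $\mathrm{time}(x)=\max_y \mathrm{time}(y)\cdot(|C_x|(\delta(G)-1)+1)$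 otherwise. *)

theory Defs
  imports "Graph_Theory.Graph_Theory"
begin

section \<open>Distances, diameter and cut sets\<close>

text \<open>Finite simple undirected graphs are represented by the locale \<^locale>\<open>graph\<close>, i.e. as
  finite, loop-free, symmetric digraphs without parallel arcs: an edge is a pair of opposite
  arcs.\<close>

definition (in pre_digraph) gdist :: "'a \<Rightarrow> 'a \<Rightarrow> nat" where
  "gdist u v = (INF p \<in> {p. awalk u p v}. length p)"

lemma (in wf_digraph) gdist_eq_\<mu>:
  assumes "u \<rightarrow>\<^sup>* v"
  shows "\<mu> (\<lambda>_. 1) u v = ereal (real (gdist u v))"
proof -
  have cost: "awalk_cost (\<lambda>_. 1) p = real (length p)" for p
    by (induct p) auto
  have ne: "length ` {p. awalk u p v} \<noteq> {}"
    using assms by (auto simp: reachable_awalk)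
  obtain q where q: "awalk u q v" "length q = gdist u v"
    using Inf_nat_def1[OF ne] unfolding gdist_def by auto
  have le: "gdist u v \<le> length p" if "awalk u p v" for p
    unfolding gdist_def using that by (auto intro: cINF_lower)
  show ?thesis
    unfolding \<mu>_def cost
  proof (rule antisym)
    show "(INF p\<in>{p. awalk u p v}. ereal (real (length p))) \<le> ereal (real (gdist u v))"
      using q by (intro INF_lower2[of q]) auto
    show "ereal (real (gdist u v)) \<le> (INF p\<in>{p. awalk u p v}. ereal (real (length p)))"
      using le by (intro INF_greatest) auto
  qed
qed

definition (in pre_digraph) shortest_path :: "'a \<Rightarrow> 'b awalk \<Rightarrow> 'a \<Rightarrow> bool" where
  "shortest_path u p v \<longleftrightarrow> apath u p v \<and> length p = gdist u v"

definition (in pre_digraph) diam :: nat where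
  "diam = Max {gdist u v | u v. u \<in> verts G \<and> v \<in> verts G}"

text \<open>A cut set is a set of vertices whose deletion leaves a disconnected graph. The empty graph
  does not satisfy \<^const>\<open>Digraph_Component.connected\<close>, but it does not count as disconnected
  here, hence the second conjunct.\<close>

definition cut_set :: "('a, 'b) pre_digraph \<Rightarrow> 'a set \<Rightarrow> bool" where
  "cut_set H S \<longleftrightarrow> S \<subseteq> verts H \<and> verts H - S \<noteq> {}
     \<and> \<not> Digraph_Component.connected (H \<restriction> (verts H - S))"


section \<open>Rooted trees and cut decompositions\<close>

text \<open>A finite rooted tree with all arcs directed away from the root. (The library's
  \<^const>\<open>tree\<close> only excludes directed cycles, so it does not describe oriented trees.)\<close>

locale rooted_tree = fin_digraph X for X :: "('x, 'y) pre_digraph" +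
  fixes root :: 'x
  assumes root_in_verts: "root \<in> verts X"
    and unique_awalk: "v \<in> verts X \<Longrightarrow> \<exists>!p. awalk root p v"
begin

lemma wf_child: "wf {(y, x). x \<rightarrow>\<^bsub>X\<^esub> y}"
proof -
  have "\<not> x \<rightarrow>\<^sup>+\<^bsub>X\<^esub> x" for x
  proof
    assume "x \<rightarrow>\<^sup>+\<^bsub>X\<^esub> x"
    then obtain p where p: "awalk x p x" "p \<noteq> []"
      by (auto simp: reachable1_awalk)
    then obtain q where q: "awalk root q x"
      using unique_awalk[of x] awalk_hd_in_verts by blast
    have "awalk root (q @ p) x"
      using p q by auto
    with q have "q = q @ p"
      using unique_awalk[of x] awalk_last_in_verts by blast
    with p(2) show False
      by simp
  qed
  then have "acyclic (arcs_ends X)"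
    by (auto simp: acyclic_def)
  moreover have "finite (arcs_ends X)"
    by (simp add: arcs_ends_def)
  ultimately have "wf ((arcs_ends X)\<inverse>)"
    by (rule finite_acyclic_wf_converse[rotated])
  moreover have "(arcs_ends X)\<inverse> = {(y, x). x \<rightarrow>\<^bsub>X\<^esub> y}"
    by auto
  ultimately show ?thesis
    by simp
qed

definition children :: "'x \<Rightarrow> 'x set" where
  "children x = {y. x \<rightarrow>\<^bsub>X\<^esub> y}"

definition is_leaf :: "'x \<Rightarrow> bool" where
  "is_leaf x \<longleftrightarrow> x \<in> verts X \<and> children x = {}"

definition ancestor :: "'x \<Rightarrow> 'x \<Rightarrow> bool" where
  "ancestor x y \<longleftrightarrow> x \<rightarrow>\<^sup>*\<^bsub>X\<^esub> y"

definition subtree_nodes :: "'x \<Rightarrow> 'x set" where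
  "subtree_nodes x = {y. ancestor x y}"

definition subtree_verts :: "('x \<Rightarrow> 'a set) \<Rightarrow> 'x \<Rightarrow> 'a set" where
  "subtree_verts C x = (\<Union>y \<in> subtree_nodes x. C y)"

function load :: "('x \<Rightarrow> 'a set) \<Rightarrow> 'x \<Rightarrow> nat" where
  "load C x = (if children x = {} then card (C x)
               else card (C x) + Max ((\<lambda>y. load C y) ` children x))"
  by auto
termination
  by (relation "inv_image {(y, x). x \<rightarrow>\<^bsub>X\<^esub> y} snd") (auto simp: wf_child children_def)

text \<open>Integer-valued, because the factor \<open>diam - 1\<close> is \<open>-1\<close> for the one-vertex graph.\<close>

function time :: "('a, 'b) pre_digraph \<Rightarrow> ('x \<Rightarrow> 'a set) \<Rightarrow> 'x \<Rightarrow> int" where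
  "time G C x =
     (if children x = {} then int (card (C x)) * (int (pre_digraph.diam G) - 1) + 1
      else Max ((\<lambda>y. time G C y) ` children x)
             * (int (card (C x)) * (int (pre_digraph.diam G) - 1) + 1))"
  by auto
termination
  by (relation "inv_image {(y, x). x \<rightarrow>\<^bsub>X\<^esub> y} (snd \<circ> snd)") (auto simp: wf_child children_def)

declare load.simps [simp del] time.simps [simp del]

end

text \<open>Edges are unordered, whereas each edge is represented by two arcs; hence the disjunction
  in \<open>edge_ancestor\<close>.\<close>

locale cut_decomposition = rooted_tree X root
  for G :: "('a, 'b) pre_digraph" and X :: "('x, 'y) pre_digraph" and root :: 'x +
  fixes C :: "'x \<Rightarrow> 'a set"
  assumes bag_subset: "x \<in> verts X \<Longrightarrow> C x \<subseteq> verts G"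
    and unique_bag: "v \<in> verts G \<Longrightarrow> \<exists>!x. x \<in> verts X \<and> v \<in> C x"
    and edge_ancestor: "u \<rightarrow>\<^bsub>G\<^esub> v \<Longrightarrow>
      \<exists>x \<in> verts X. \<exists>y \<in> verts X. u \<in> C x \<and> v \<in> C y \<and> (ancestor x y \<or> ancestor y x)"
    and bag_cut_set: "\<lbrakk>y \<in> verts X; \<not> is_leaf y\<rbrakk> \<Longrightarrow>
      cut_set (G \<restriction> subtree_verts C y) (C y)"


section \<open>Lazy zombies and survivor\<close>

text \<open>A configuration consists of the list of positions of the zombies and the position of the
  survivor. A strategy maps the history of all configurations so far (in chronological order, the
  last one being the current one) to the next positions of the zombies.\<close>

type_synonym 'a config = "'a list \<times> 'a"
type_synonym 'a strategy = "'a config list \<Rightarrow> 'a list"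

context pre_digraph
begin

definition zombie_step :: "'a \<Rightarrow> 'a \<Rightarrow> 'a \<Rightarrow> bool" where
  "zombie_step s u v \<longleftrightarrow>
     v = u \<or> (u \<rightarrow>\<^bsub>G\<^esub> v \<and> (\<exists>p. shortest_path u p s \<and> v \<in> set (awalk_verts u p)))"

definition survivor_step :: "'a \<Rightarrow> 'a \<Rightarrow> bool" where
  "survivor_step u v \<longleftrightarrow> v = u \<or> u \<rightarrow>\<^bsub>G\<^esub> v"

definition zombie_strategy :: "'a strategy \<Rightarrow> bool" where
  "zombie_strategy \<sigma> \<longleftrightarrow> (\<forall>h z s. list_all2 (zombie_step s) z (\<sigma> (h @ [(z, s)])))"

text \<open>\<open>Z t\<close> and \<open>S t\<close> are the positions after round \<open>t\<close> (for \<open>t = 0\<close>, the initial ones), where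
  the zombies start from \<open>z0\<close>, follow \<open>\<sigma>\<close>, and the survivor never leaves \<open>R\<close>. Plays are continued
  beyond a capture; this is harmless since both sides are always allowed to stay put.\<close>

definition play :: "'a strategy \<Rightarrow> 'a set \<Rightarrow> 'a list \<Rightarrow> (nat \<Rightarrow> 'a list) \<Rightarrow> (nat \<Rightarrow> 'a) \<Rightarrow> bool" where
  "play \<sigma> R z0 Z S \<longleftrightarrow>
     Z 0 = z0 \<and> (\<forall>t. Z (Suc t) = \<sigma> (map (\<lambda>j. (Z j, S j)) [0..<Suc t])) \<and>
     (\<forall>t. S t \<in> R) \<and> (\<forall>t. survivor_step (S t) (S (Suc t)))"

text \<open>A capture in round \<open>t > 0\<close> happens either directly after the move of the zombies, when the
  survivor is still at \<open>S (t - 1)\<close>, or after the move of the survivor.\<close>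

definition captured_in_round :: "(nat \<Rightarrow> 'a list) \<Rightarrow> (nat \<Rightarrow> 'a) \<Rightarrow> nat \<Rightarrow> bool" where
  "captured_in_round Z S t \<longleftrightarrow> S t \<in> set (Z t) \<or> (t > 0 \<and> S (t - 1) \<in> set (Z t))"

definition zombies_capture :: "nat \<Rightarrow> 'a set \<Rightarrow> int \<Rightarrow> bool" where
  "zombies_capture k R T \<longleftrightarrow>
     (\<forall>z0. length z0 = k \<and> set z0 \<subseteq> verts G \<longrightarrow>
        (\<exists>\<sigma>. zombie_strategy \<sigma> \<and>
           (\<forall>Z S. play \<sigma> R z0 Z S \<longrightarrow> (\<exists>t. int t \<le> T \<and> captured_in_round Z S t))))"

end

end

theory Submission
  imports Defs
begin

text \<open>Every vertex \<open>c\<close> of the bag \<open>C\<^sub>x\<close> gets its own guard, which moves only when the survivor stands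
  on \<open>c\<close>, and then one step closer to \<open>c\<close>. Hence the potential \<open>\<Sum>\<^sub>c (d(guard c, c) - 1)\<close>, initially
  at most \<open>|C\<^sub>x| (\<delta>(G) - 1)\<close>, drops with every visit of the survivor to \<open>C\<^sub>x\<close> that does not end in
  a capture. Between two visits the survivor is confined to the subtree of a single child \<open>y\<close> of
  \<open>x\<close>, where the remaining zombies, wherever they currently are, win within \<open>time(y)\<close> rounds. The
  visit that ends such a phase fits into the rounds reserved for the phase: if the survivor left
  only in the last one, it would be captured by the preceding move of the zombies, because it
  would also be captured when staying put.\<close>

section \<open>Distances\<close>

context wf_digraph
begin

lemma gdist_le_length: "awalk u p v \<Longrightarrow> gdist u v \<le> length p"
  unfolding gdist_def by (auto intro: cINF_lower)

lemma shortest_awalk: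
  assumes "u \<rightarrow>\<^sup>* v"
  obtains p where "awalk u p v" "length p = gdist u v"
proof -
  have "length ` {p. awalk u p v} \<noteq> {}"
    using assms by (auto simp: reachable_awalk)
  from Inf_nat_def1[OF this] show ?thesis
    using that unfolding gdist_def by auto
qed

lemma gdist_eq_0D:
  assumes "u \<rightarrow>\<^sup>* v" "gdist u v = 0"
  shows "u = v"
  using shortest_awalk[OF assms(1)] assms(2) by (metis awalk_Nil_iff length_0_conv)

text \<open>A repeated vertex would allow a closed subwalk to be cut out, leaving a walk shorter
  than the distance.\<close>

lemma shortest_awalk_imp_shortest_path:
  assumes "awalk u p v" "length p = gdist u v"
  shows "shortest_path u p v"
proof (rule ccontr)
  assume "\<not> shortest_path u p v"
  with assms have "\<not> distinct (awalk_verts u p)"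
    by (simp add: shortest_path_def apath_def)
  from awalk_not_distinct_decomp[OF assms(1) this] obtain q r s w
    where "p = q @ r @ s" "0 < length r" "awalk u q w" "awalk w s v"
    by blast
  then have "awalk u (q @ s) v" "length (q @ s) < length p"
    by auto
  with gdist_le_length[of u "q @ s" v] assms(2) show False
    by simp
qed

lemma zombie_step_closer:
  assumes "u \<rightarrow>\<^sup>* s" "u \<noteq> s"
  obtains v where "zombie_step s u v" "v \<in> verts G" "Suc (gdist v s) \<le> gdist u s"
proof -
  obtain p where p: "awalk u p s" "length p = gdist u s"
    using shortest_awalk[OF assms(1)] .
  then obtain e q where pe: "p = e # q"
    using assms(2) by (cases p) (auto simp: awalk_Nil_iff)
  then have e: "e \<in> arcs G" "u = tail G e" and q: "awalk (head G e) q s"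
    using p(1) by (auto simp: awalk_Cons_iff)
  have "head G e \<in> set (awalk_verts u p)"
    using hd_in_awalk_verts(1)[OF q] pe by simp
  moreover have "u \<rightarrow> head G e"
    using e by (simp add: in_arcs_imp_in_arcs_ends)
  ultimately have "zombie_step s u (head G e)"
    using shortest_awalk_imp_shortest_path[OF p] unfolding zombie_step_def by blast
  moreover have "Suc (gdist (head G e) s) \<le> gdist u s"
    using gdist_le_length[OF q] p(2) pe by simp
  ultimately show ?thesis
    using that e(1) by auto
qed

lemma zombie_step_in_verts: "zombie_step s u v \<Longrightarrow> u \<in> verts G \<Longrightarrow> v \<in> verts G"
  unfolding zombie_step_def by (auto dest: adj_in_verts)

lemma zombie_steps_in_verts:
  assumes "list_all2 (zombie_step s) z z'" "set z \<subseteq> verts G"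
  shows "set z' \<subseteq> verts G"
  using assms by (induction rule: list_all2_induct) (auto dest: zombie_step_in_verts)

end

lemma (in fin_digraph) gdist_le_diam:
  assumes "u \<in> verts G" "v \<in> verts G"
  shows "gdist u v \<le> diam"
proof -
  have "{gdist u v | u v. u \<in> verts G \<and> v \<in> verts G} = case_prod gdist ` (verts G \<times> verts G)"
    by auto
  then have "finite {gdist u v | u v. u \<in> verts G \<and> v \<in> verts G}"
    by simp
  with assms show ?thesis
    unfolding diam_def by (intro Max_ge) auto
qed

section \<open>Positions from which the zombies can force a capture\<close>

context pre_digraph
begin

text \<open>Backward induction on the number of remaining rounds, free of histories. The inner
  disjunction covers a capture by the move of the zombies, before the survivor replies. The region
  \<open>R\<close> restricts only these replies.\<close>

primrec capturable :: "nat \<Rightarrow> 'a set \<Rightarrow> 'a list \<Rightarrow> 'a \<Rightarrow> bool" where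
  "capturable 0 R z s \<longleftrightarrow> s \<in> set z"
| "capturable (Suc n) R z s \<longleftrightarrow> s \<in> set z \<or>
     (\<exists>z'. list_all2 (zombie_step s) z z' \<and>
        (s \<in> set z' \<or> (\<forall>s' \<in> R. survivor_step s s' \<longrightarrow> capturable n R z' s')))"

lemma zombie_step_refl [simp]: "zombie_step s u u"
  by (simp add: zombie_step_def)

lemma zombie_steps_refl [simp]: "list_all2 (zombie_step s) z z"
  by (simp add: list_all2_refl)

lemma survivor_step_refl [simp]: "survivor_step s s"
  by (simp add: survivor_step_def)

lemma capturable_if_in: "s \<in> set z \<Longrightarrow> capturable n R z s"
  by (cases n) auto

lemma capturable_Suc: "capturable n R z s \<Longrightarrow> capturable (Suc n) R z s"
proof (induction n arbitrary: z s)
  case (Suc n)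
  from Suc.prems show ?case
    by (subst capturable.simps(2), subst (asm) capturable.simps(2)) (blast intro: Suc.IH)
qed auto

lemma capturable_mono: "capturable m R z s \<Longrightarrow> m \<le> n \<Longrightarrow> capturable n R z s"
  by (induction n) (auto simp del: capturable.simps(2) intro: capturable_Suc simp: le_Suc_eq)

text \<open>The additional zombies stay put, so a subtree of small load can be played with a surplus
  of zombies.\<close>

lemma capturable_append: "capturable n R z s \<Longrightarrow> capturable n R (z @ w) s"
proof (induction n arbitrary: z s)
  case (Suc n)
  show ?case
  proof (cases "s \<in> set z")
    case False
    with Suc.prems obtain z' where "list_all2 (zombie_step s) z z'"
      and "s \<in> set z' \<or> (\<forall>s' \<in> R. survivor_step s s' \<longrightarrow> capturable n R z' s')"
      by auto
    with Suc.IH show ?thesis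
      by (auto intro!: exI[of _ "z' @ w"] list_all2_appendI)
  qed simp
qed simp

text \<open>The length of the history tells how many rounds remain, so a strategy can choose a
  winning move for that number. Along a play without capture the position then stays capturable in
  the remaining rounds.\<close>

lemma zombies_capture_if_capturable:
  assumes "0 \<le> T"
    and capt: "\<And>z s. \<lbrakk>length z = k; set z \<subseteq> verts G; s \<in> R\<rbrakk> \<Longrightarrow> capturable (nat T) R z s"
  shows "zombies_capture k R T"
  unfolding zombies_capture_def
proof (intro allI impI)
  fix z0 :: "'a list"
  assume z0: "length z0 = k \<and> set z0 \<subseteq> verts G"
  define good where "good n z s z' \<longleftrightarrow> list_all2 (zombie_step s) z z' \<and>
    (s \<in> set z' \<or> (\<forall>s' \<in> R. survivor_step s s' \<longrightarrow> capturable n R z' s'))" for n z s z'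
  \<comment> \<open>In round \<open>t + 1\<close> the history has length \<open>t + 1\<close>, so
    \<open>n\<close> counts the rounds left after the move. Staying put is the default that keeps
    the strategy legal on every history.\<close>
  define \<sigma> :: "'a strategy" where "\<sigma> h =
    (let n = nat T - length h; z = fst (last h); s = snd (last h)
     in if \<exists>z'. good n z s z' then SOME z'. good n z s z' else z)" for h
  have "zombie_strategy \<sigma>"
    unfolding zombie_strategy_def
  proof (intro allI)
    fix h :: "'a config list" and z s
    let ?n = "nat T - length (h @ [(z, s)])"
    show "list_all2 (zombie_step s) z (\<sigma> (h @ [(z, s)]))"
    proof (cases "\<exists>z'. good ?n z s z'")
      case True
      then have "good ?n z s (\<sigma> (h @ [(z, s)]))"
        by (auto simp: \<sigma>_def Let_def intro: someI)
      then show ?thesis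
        by (simp add: good_def)
    next
      case False
      then show ?thesis
        by (auto simp: \<sigma>_def Let_def)
    qed
  qed
  moreover have "\<exists>t. int t \<le> T \<and> captured_in_round Z S t" if play: "play \<sigma> R z0 Z S" for Z S
  proof (rule ccontr)
    assume none: "\<not> ?thesis"
    have SR: "S t \<in> R" and SS: "survivor_step (S t) (S (Suc t))"
      and ZS: "Z (Suc t) = \<sigma> (map (\<lambda>j. (Z j, S j)) [0..<Suc t])" for t
      using play by (auto simp: play_def)
    have not_capt: "\<not> captured_in_round Z S t" if "t \<le> nat T" for t
      using none that \<open>0 \<le> T\<close> by (metis int_nat_eq of_nat_le_iff)
    have "capturable (nat T - t) R (Z t) (S t)" if "t \<le> nat T" for t
      using that
    proof (induction t)
      case 0
      then show ?case
        using capt[of z0 "S 0"] z0 SR play by (simp add: play_def)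
    next
      case (Suc t)
      define n where "n = nat T - Suc t"
      have "nat T - t = Suc n"
        using Suc.prems by (simp add: n_def)
      with Suc have "capturable (Suc n) R (Z t) (S t)"
        by simp
      moreover have "S t \<notin> set (Z t)"
        using not_capt[of t] Suc.prems by (simp add: captured_in_round_def)
      ultimately have "\<exists>z'. good n (Z t) (S t) z'"
        by (simp add: good_def)
      then have "good n (Z t) (S t) (Z (Suc t))"
        unfolding ZS by (auto simp: \<sigma>_def Let_def n_def intro: someI)
      moreover have "S t \<notin> set (Z (Suc t))"
        using not_capt[of "Suc t"] Suc.prems by (simp add: captured_in_round_def)
      ultimately show ?case
        using SR SS by (simp add: good_def n_def)
    qed
    from this[of "nat T"] have "S (nat T) \<in> set (Z (nat T))"
      by simp
    with not_capt[of "nat T"] show False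
      by (simp add: captured_in_round_def)
  qed
  ultimately show "\<exists>\<sigma>. zombie_strategy \<sigma> \<and>
      (\<forall>Z S. play \<sigma> R z0 Z S \<longrightarrow> (\<exists>t. int t \<le> T \<and> captured_in_round Z S t))"
    by blast
qed

text \<open>By truncated subtraction a guard at distance 0 or 1 contributes nothing: it captures at
  the next visit to its vertex.\<close>

definition guard_potential :: "'a list \<Rightarrow> 'a list \<Rightarrow> nat" where
  "guard_potential cs g = (\<Sum>i<length cs. gdist (g ! i) (cs ! i) - 1)"

end

section \<open>Guarding a set of vertices\<close>

context fin_digraph
begin

lemma guard_potential_le:
  assumes "set cs \<subseteq> verts G" "set g \<subseteq> verts G" "length g = length cs"
  shows "guard_potential cs g \<le> length cs * (diam - 1)"
proof -
  have "gdist (g ! i) (cs ! i) - 1 \<le> diam - 1" if "i < length cs" for i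
    using that assms by (intro diff_le_mono gdist_le_diam) (auto simp: subset_iff)
  then have "guard_potential cs g \<le> (\<Sum>i<length cs. diam - 1)"
    unfolding guard_potential_def by (intro sum_mono) auto
  then show ?thesis
    by simp
qed

text \<open>At distance at least 2 the truncated difference is positive, so one step closer makes it
  strictly smaller.\<close>

lemma guard_potential_less:
  assumes "i < length cs" "length g = length cs"
    and "Suc (gdist v (cs ! i)) \<le> gdist (g ! i) (cs ! i)" "2 \<le> gdist (g ! i) (cs ! i)"
  shows "guard_potential cs (g[i := v]) < guard_potential cs g"
  unfolding guard_potential_def
proof (rule sum_strict_mono_ex1)
  show "\<forall>j\<in>{..<length cs}. gdist (g[i := v] ! j) (cs ! j) - 1 \<le> gdist (g ! j) (cs ! j) - 1"
    using assms by (auto simp: nth_list_update)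
  show "\<exists>j\<in>{..<length cs}. gdist (g[i := v] ! j) (cs ! j) - 1 < gdist (g ! j) (cs ! j) - 1"
    using assms by (intro bexI[of _ i]) (auto simp: nth_list_update)
qed simp

text \<open>The set \<open>R'\<close> is a region that the survivor cannot leave without entering the guarded set.\<close>

lemma capturable_with_guards:
  assumes sc: "strongly_connected G"
    and cs: "set cs \<subseteq> verts G" and T: "1 \<le> T"
    and regions: "\<And>s. \<lbrakk>s \<in> R; s \<notin> set cs\<rbrakk> \<Longrightarrow> \<exists>R'. s \<in> R' \<and>
        (\<forall>u \<in> R'. \<forall>v \<in> R. survivor_step u v \<longrightarrow> v \<in> R' \<union> set cs) \<and>
        (\<forall>w. length w = m \<longrightarrow> set w \<subseteq> verts G \<longrightarrow> capturable T R' w s)"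
    and "s \<in> R" "length g = length cs" "length w = m" "set g \<subseteq> verts G" "set w \<subseteq> verts G"
  shows "capturable (Suc (guard_potential cs g) * T) R (g @ w) s"
  using assms(5-)
proof (induction "guard_potential cs g" arbitrary: g w s rule: less_induct)
  case less
  \<comment> \<open>A visit to \<open>cs\<close> costs one round: either the guard captures, or the
    potential drops and \<open>guard_potential cs g * T\<close> rounds suffice afterwards. The other
    zombies may be anywhere, since the induction hypothesis allows any start.\<close>
  have visit: "capturable (Suc n) R (g @ w') s'"
    if s': "s' \<in> set cs" and n: "guard_potential cs g * T \<le> n"
      and w': "length w' = m" "set w' \<subseteq> verts G" for n w' s'
  proof -
    obtain i where i: "i < length cs" "s' = cs ! i"
      using s' by (auto simp: in_set_conv_nth)
    have gi: "g ! i \<in> set g"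
      using i less.prems(2) by simp
    show ?thesis
    proof (cases "g ! i = s'")
      case True
      then show ?thesis
        using gi by (intro capturable_if_in) auto
    next
      case False
      have reach: "u \<rightarrow>\<^sup>* s'" if "u \<in> verts G" for u
        using sc that s' cs by auto
      obtain v where v: "zombie_step s' (g ! i) v" "v \<in> verts G"
          "Suc (gdist v s') \<le> gdist (g ! i) s'"
        using zombie_step_closer[OF reach False] gi less.prems(4) by blast
      let ?z = "g[i := v] @ w'"
      have step: "list_all2 (zombie_step s') (g @ w') ?z"
        using v(1) i(1) less.prems(2)
        by (intro list_all2_appendI) (auto simp: list_all2_conv_all_nth nth_list_update)
      show ?thesis
      proof (cases "gdist (g ! i) s' \<ge> 2")
        case True
        have less_pot: "guard_potential cs (g[i := v]) < guard_potential cs g"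
          using guard_potential_less[of i cs g v] True v(3) i less.prems(2) by simp
        then have le: "Suc (guard_potential cs (g[i := v])) * T \<le> n"
          using n by (meson Suc_leI le_trans mult_le_mono1)
        have "capturable n R ?z s''" if "s'' \<in> R" for s''
        proof (rule capturable_mono[OF less.hyps[OF less_pot that] le])
          show "set (g[i := v]) \<subseteq> verts G"
            using set_update_subset_insert[of g i v] v(2) less.prems(4) by auto
        qed (use less.prems w' in auto)
        with step show ?thesis
          by auto
      next
        case False
        \<comment> \<open>The guard was at distance at most 1, so its step lands on
          \<open>s'\<close>.\<close>
        then have "v = s'"
          using v gdist_eq_0D[OF reach, of v] by simp
        then have "s' \<in> set ?z"
          using i less.prems(2) by (auto intro: set_update_memI)
        with step show ?thesis
          by auto
      qed
    qed
  qed
  show ?case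
  proof (cases "s \<in> set cs")
    case True
    \<comment> \<open>Since \<open>1 \<le> T\<close>, one round can be set aside for the
      visit.\<close>
    have eq: "Suc (guard_potential cs g) * T = Suc (guard_potential cs g * T + (T - 1))"
      using T by simp
    show ?thesis
      unfolding eq using less.prems by (intro visit[OF True]) auto
  next
    case False
    from regions[OF less.prems(1) this] obtain R' where R': "s \<in> R'"
        "\<forall>u \<in> R'. \<forall>v \<in> R. survivor_step u v \<longrightarrow> v \<in> R' \<union> set cs"
        "capturable T R' w s"
      using less.prems(3,5) by (elim exE conjE) simp
    \<comment> \<open>The guards stand still while the others play the game confined to
      \<open>R'\<close>. Of this phase \<open>n\<close> rounds remain; the other summand is the
      reserve for later phases.\<close>
    have "capturable (guard_potential cs g * T + n) R (g @ w') s'"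
      if "capturable n R' w' s'" "s' \<in> R'" "length w' = m" "set w' \<subseteq> verts G" for n w' s'
      using that
    proof (induction n arbitrary: w' s')
      case 0
      then show ?case
        by (auto intro: capturable_if_in)
    next
      case (Suc n)
      show ?case
      proof (cases "s' \<in> set w'")
        case True
        then show ?thesis
          by (intro capturable_if_in) simp
      next
        case False
        with Suc.prems(1) obtain w'' where w'': "list_all2 (zombie_step s') w' w''"
          and win: "s' \<in> set w'' \<or> (\<forall>v \<in> R'. survivor_step s' v \<longrightarrow> capturable n R' w'' v)"
          by auto
        have len: "length w'' = m" and sub: "set w'' \<subseteq> verts G"
          using w'' Suc.prems(3,4) by (auto dest: list_all2_lengthD zombie_steps_in_verts)
        have "s' \<in> set w'' \<or>
          (\<forall>v \<in> R. survivor_step s' v \<longrightarrow> capturable (guard_potential cs g * T + n) R (g @ w'') v)"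
        proof (cases "s' \<in> set w''")
          case notin: False
          \<comment> \<open>Staying at \<open>s'\<close> is a possible reply within
            \<open>R'\<close>. It does not meet a zombie, so the phase has a further round, which
            can pay for a visit to \<open>cs\<close>.\<close>
          have "capturable n R' w'' s'"
            using win notin \<open>s' \<in> R'\<close> by auto
          with notin obtain k where k: "n = Suc k"
            by (cases n) auto
          have "capturable (guard_potential cs g * T + n) R (g @ w'') v"
            if v: "v \<in> R" "survivor_step s' v" for v
          proof (cases "v \<in> R'")
            case True
            then show ?thesis
              using win notin v(2) Suc.IH len sub by blast
          next
            case False
            then have "v \<in> set cs"
              using R'(2) Suc.prems(2) v by blast
            from visit[OF this _ len sub, of "guard_potential cs g * T + k"] k show ?thesis
              by simp
          qed
          then show ?thesis
            by blast
        qed simp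
        moreover have "list_all2 (zombie_step s') (g @ w') (g @ w'')"
          using w'' by (intro list_all2_appendI) auto
        ultimately show ?thesis
          by (auto intro!: exI[of _ "g @ w''"])
      qed
    qed
    from this[OF R'(3,1)] less.prems show ?thesis
      by (simp add: add.commute)
  qed
qed

text \<open>The first \<open>card A\<close> zombies become guards, one for each vertex of
  \<open>A\<close>, and the other \<open>m\<close> play the phases. The diameter bounds the initial
  potential.\<close>

lemma capturable_guarding_finite:
  assumes "strongly_connected G" "A \<subseteq> verts G" "1 \<le> T"
    and "\<And>s. \<lbrakk>s \<in> R; s \<notin> A\<rbrakk> \<Longrightarrow> \<exists>R'. s \<in> R' \<and>
        (\<forall>u \<in> R'. \<forall>v \<in> R. survivor_step u v \<longrightarrow> v \<in> R' \<union> A) \<and>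
        (\<forall>w. length w = m \<longrightarrow> set w \<subseteq> verts G \<longrightarrow> capturable T R' w s)"
    and "s \<in> R" "length z = card A + m" "set z \<subseteq> verts G"
  shows "capturable (Suc (card A * (diam - 1)) * T) R z s"
proof -
  have "finite A"
    using assms(2) by (rule finite_subset) simp
  then obtain cs where cs: "set cs = A" "length cs = card A"
    using finite_distinct_list distinct_card by metis
  let ?g = "take (card A) z" and ?w = "drop (card A) z"
  have g: "length ?g = length cs" "set ?g \<subseteq> verts G"
    and w: "length ?w = m" "set ?w \<subseteq> verts G"
    using assms(6,7) cs(2) by (auto dest: in_set_takeD in_set_dropD)
  have "capturable (Suc (guard_potential cs ?g) * T) R (?g @ ?w) s"
    using assms(1-5) g w by (intro capturable_with_guards[where m = m]) (simp_all add: cs(1))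
  moreover have "guard_potential cs ?g \<le> card A * (diam - 1)"
    using guard_potential_le[of cs ?g] g cs assms(2) by simp
  ultimately show ?thesis
    by (auto intro: capturable_mono mult_le_mono1)
qed

end

section \<open>Ancestors in rooted trees\<close>

context rooted_tree
begin

text \<open>Prefixing both walks with one from the root to \<open>u\<close> gives two walks from the
  root to \<open>v\<close>, which coincide.\<close>

lemma awalk_unique:
  assumes "awalk u p v" "awalk u q v"
  shows "p = q"
proof -
  obtain p0 where "awalk root p0 u"
    using unique_awalk awalk_hd_in_verts[OF assms(1)] by blast
  with assms have "awalk root (p0 @ p) v" "awalk root (p0 @ q) v"
    by auto
  then show ?thesis
    using unique_awalk[of v] awalk_last_in_verts[OF assms(1)] by blast
qed

lemma ancestor_refl: "x \<in> verts X \<Longrightarrow> ancestor x x"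
  by (simp add: ancestor_def)

lemma ancestor_trans: "ancestor x y \<Longrightarrow> ancestor y z \<Longrightarrow> ancestor x z"
  unfolding ancestor_def by (rule reachable_trans)

lemma ancestor_in_verts: "ancestor x y \<Longrightarrow> x \<in> verts X" "ancestor x y \<Longrightarrow> y \<in> verts X"
  unfolding ancestor_def by (auto dest: reachable_in_verts)

text \<open>The walks from the root to \<open>c\<close> through \<open>a\<close> and through
  \<open>b\<close> coincide, so one initial piece is a prefix of the other.\<close>

lemma ancestor_linear:
  assumes "ancestor a c" "ancestor b c"
  shows "ancestor a b \<or> ancestor b a"
proof -
  obtain p where p: "awalk root p a"
    using unique_awalk[OF ancestor_in_verts(1)[OF assms(1)]] by blast
  obtain q where q: "awalk root q b"
    using unique_awalk[OF ancestor_in_verts(1)[OF assms(2)]] by blast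
  obtain p' q' where p': "awalk a p' c" and q': "awalk b q' c"
    using assms by (auto simp: ancestor_def reachable_awalk)
  have "awalk root (p @ p') c" "awalk root (q @ q') c"
    using p p' q q' by auto
  then have "p @ p' = q @ q'"
    by (rule awalk_unique)
  then consider us where "p @ us = q" | us where "q @ us = p"
    by (auto simp: append_eq_append_conv2)
  then show ?thesis
  proof cases
    case 1
    then have "awalk a us b"
      using p q by (auto simp: awalk_append_iff)
    then show ?thesis
      by (auto simp: ancestor_def reachable_awalk)
  next
    case 2
    then have "awalk b us a"
      using p q by (auto simp: awalk_append_iff)
    then show ?thesis
      by (auto simp: ancestor_def reachable_awalk)
  qed
qed

lemma between_parent_and_child:
  assumes "y \<in> children x" "ancestor x b" "ancestor b y"
  shows "b = x \<or> b = y"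
proof -
  obtain e where "e \<in> arcs X" "tail X e = x" "head X e = y"
    using assms(1) by (auto simp: children_def)
  then have e: "awalk x [e] y"
    using arc_implies_awalk by blast
  obtain p q where p: "awalk x p b" and q: "awalk b q y"
    using assms(2,3) by (auto simp: ancestor_def reachable_awalk)
  then have "awalk x (p @ q) y"
    by auto
  with e have "p @ q = [e]"
    using awalk_unique by blast
  then have "p = [] \<or> q = []"
    by (auto simp: append_eq_Cons_conv)
  with p q show ?thesis
    by (auto simp: awalk_Nil_iff)
qed

lemma children_subset_verts: "children x \<subseteq> verts X"
  by (auto simp: children_def dest: adj_in_verts)

lemma finite_children [simp]: "finite (children x)"
  using children_subset_verts by (rule finite_subset) simp

lemma child_ancestor: "y \<in> children x \<Longrightarrow> ancestor x y"
  by (auto simp: children_def ancestor_def)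

lemma subtree_verts_eq:
  assumes "x \<in> verts X"
  shows "subtree_verts C x = C x \<union> (\<Union>y \<in> children x. subtree_verts C y)"
proof -
  have "subtree_nodes x = insert x (\<Union>y \<in> children x. subtree_nodes y)"
    unfolding subtree_nodes_def
    using assms
    by (auto simp: ancestor_refl intro: ancestor_trans child_ancestor)
      (auto simp: ancestor_def children_def elim: converse_reachable_cases)
  then show ?thesis
    by (auto simp: subtree_verts_def)
qed

text \<open>With diameter at least 1 every factor is at least 1. Hence each phase in a child's
  subtree has the round that guarding requires.\<close>

lemma time_pos:
  assumes "1 \<le> pre_digraph.diam G"
  shows "1 \<le> time G C x"
proof (induction x rule: wf_induct[OF wf_child])
  case (1 x)
  have bag: "1 \<le> int (card (C x)) * (int (pre_digraph.diam G) - 1) + 1"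
    using assms by simp
  show ?case
  proof (cases "children x = {}")
    case True
    then show ?thesis
      using bag by (simp add: time.simps[of G C x])
  next
    case False
    then obtain y where y: "y \<in> children x"
      by auto
    then have "1 \<le> time G C y"
      using 1 by (simp add: children_def)
    also have "\<dots> \<le> Max (time G C ` children x)"
      using y by simp
    finally have "1 * 1 \<le> Max (time G C ` children x)
        * (int (card (C x)) * (int (pre_digraph.diam G) - 1) + 1)"
      using bag by (intro mult_mono) auto
    then show ?thesis
      using False by (simp add: time.simps[of G C x])
  qed
qed

end

section \<open>Capturing the survivor in a subtree of a cut decomposition\<close>

context cut_decomposition
begin

lemma subtree_verts_subset: "subtree_verts C x \<subseteq> verts G"
  using bag_subset by (auto simp: subtree_verts_def subtree_nodes_def dest: ancestor_in_verts)

text \<open>The bags of \<open>u\<close> and \<open>v\<close> belong to comparable nodes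
  \<open>a\<close> and \<open>b\<close>. If \<open>b\<close> is an ancestor of \<open>a\<close>, it
  is comparable with \<open>y\<close>; between \<open>x\<close> and \<open>y\<close> there are no
  further nodes, and \<open>b = x\<close> is excluded by \<open>v \<notin> C x\<close>.\<close>

lemma survivor_confined_to_child:
  assumes y: "y \<in> children x" and u: "u \<in> subtree_verts C y" and v: "v \<in> subtree_verts C x"
    and step: "pre_digraph.survivor_step G u v" and "v \<notin> C x"
  shows "v \<in> subtree_verts C y"
proof (cases "v = u")
  case True
  with u show ?thesis
    by simp
next
  case False
  with step have "u \<rightarrow>\<^bsub>G\<^esub> v"
    by (simp add: pre_digraph.survivor_step_def)
  from edge_ancestor[OF this] obtain a b where ab: "a \<in> verts X" "b \<in> verts X" "u \<in> C a" "v \<in> C b"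
    "ancestor a b \<or> ancestor b a"
    by blast
  have bag: "ancestor z c" if w: "w \<in> subtree_verts C z" "w \<in> C c" "c \<in> verts X" for w z c
  proof -
    obtain d where d: "ancestor z d" "w \<in> C d"
      using w(1) by (auto simp: subtree_verts_def subtree_nodes_def)
    moreover have "w \<in> verts G"
      using bag_subset w by blast
    ultimately have "d = c"
      using unique_bag[of w] w ancestor_in_verts(2)[OF d(1)] by blast
    with d show ?thesis
      by simp
  qed
  have ya: "ancestor y a" and xb: "ancestor x b"
    using bag[OF u] bag[OF v] ab by auto
  have "b \<noteq> x"
    using ab(4) \<open>v \<notin> C x\<close> by blast
  have "ancestor y b"
  proof (cases "ancestor a b")
    case True
    with ya show ?thesis
      by (rule ancestor_trans)
  next
    case False
    with ab(5) have "ancestor b a"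
      by simp
    from ancestor_linear[OF ya this] show ?thesis
    proof
      assume "ancestor b y"
      with between_parent_and_child[OF y xb] \<open>b \<noteq> x\<close> have "b = y"
        by simp
      then show ?thesis
        using ab(2) by (simp add: ancestor_refl)
    qed
  qed
  with ab(4) show ?thesis
    by (auto simp: subtree_verts_def subtree_nodes_def)
qed

text \<open>Induction from the leaves upwards: \<open>card (C x)\<close> zombies guard the bag of
  \<open>x\<close>, the others follow the induction hypothesis for the child whose subtree confines
  the survivor.\<close>

lemma capturable_subtree:
  assumes "graph G" "strongly_connected G" and diam: "1 \<le> pre_digraph.diam G"
    and "x \<in> verts X" "s \<in> subtree_verts C x" "length z = load C x" "set z \<subseteq> verts G"
  shows "pre_digraph.capturable G (nat (time G C x)) (subtree_verts C x) z s"
  using assms(4-)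
proof (induction x arbitrary: s z rule: wf_induct_rule[OF wf_child])
  case (1 x)
  interpret G: graph G
    by (rule assms(1))
  show ?case
  proof (cases "children x = {}")
    case True
    have eq: "subtree_verts C x = C x"
      using subtree_verts_eq[OF 1(2)] True by simp
    have len: "length z = card (C x) + 0"
      using 1(4) True by (simp add: load.simps)
    \<comment> \<open>At a leaf the survivor always stands on a guarded vertex, so there are no
      phases: \<open>m = 0\<close> and \<open>T = 1\<close>.\<close>
    have "G.capturable (Suc (card (C x) * (G.diam - 1)) * 1) (subtree_verts C x) z s"
      using bag_subset[OF 1(2)] 1(3,5)
      by (intro G.capturable_guarding_finite[OF assms(2) _ _ _ _ len]) (auto simp: eq)
    moreover have "time G C x = int (Suc (card (C x) * (G.diam - 1)))"
      using True diam by (simp add: time.simps)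
    ultimately show ?thesis
      by (simp only: nat_int mult_1_right)
  next
    case False
    \<comment> \<open>Maxima, since the survivor decides in which child's subtree a phase takes
      place.\<close>
    define T where "T = nat (Max (time G C ` children x))"
    define m where "m = Max (load C ` children x)"
    have T_ge: "nat (time G C y) \<le> T" and m_ge: "load C y \<le> m" if "y \<in> children x" for y
      using that by (auto simp: T_def m_def intro!: nat_mono)
    obtain y0 where "y0 \<in> children x"
      using False by blast
    then have T1: "1 \<le> T"
      using T_ge[of y0] time_pos[OF diam, of C y0] by linarith
    have len: "length z = card (C x) + m"
      using 1(4) False by (simp add: load.simps[of C x] m_def)
    have region: "\<exists>R'. s' \<in> R' \<and>
        (\<forall>u \<in> R'. \<forall>v \<in> subtree_verts C x. G.survivor_step u v \<longrightarrow> v \<in> R' \<union> C x) \<and>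
        (\<forall>w. length w = m \<longrightarrow> set w \<subseteq> verts G \<longrightarrow> G.capturable T R' w s')"
      if s': "s' \<in> subtree_verts C x" "s' \<notin> C x" for s'
    proof -
      obtain y where y: "y \<in> children x" "s' \<in> subtree_verts C y"
        using s' subtree_verts_eq[OF 1(2), of C] by auto
      have "G.capturable T (subtree_verts C y) w s'"
        if w: "length w = m" "set w \<subseteq> verts G" for w
      proof -
        let ?w1 = "take (load C y) w"
        have "G.capturable (nat (time G C y)) (subtree_verts C y) ?w1 s'"
          using y w m_ge[OF y(1)] children_subset_verts
          by (intro 1(1)) (auto simp: children_def dest: in_set_takeD)
        then have "G.capturable T (subtree_verts C y) ?w1 s'"
          using T_ge[OF y(1)] by (rule G.capturable_mono)
        from G.capturable_append[OF this, of "drop (load C y) w"] show ?thesis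
          by simp
      qed
      then show ?thesis
        using y survivor_confined_to_child[OF y(1)] by (intro exI[of _ "subtree_verts C y"]) blast
    qed
    have "G.capturable (Suc (card (C x) * (G.diam - 1)) * T) (subtree_verts C x) z s"
      using bag_subset[OF 1(2)] T1 region 1(3) len 1(5)
      by (rule G.capturable_guarding_finite[OF assms(2)])
    moreover have "time G C x = int (Suc (card (C x) * (G.diam - 1)) * T)"
    proof -
      have "int T = Max (time G C ` children x)"
        using T1 unfolding T_def by linarith
      \<comment> \<open>A positive diameter makes the truncated \<open>G.diam - 1\<close> agree with
        the integer difference in \<open>time\<close>.\<close>
      moreover obtain d where "G.diam = Suc d"
        using diam by (cases G.diam) auto
      ultimately show ?thesis
        using False by (simp add: time.simps[of G C x] algebra_simps)
    qed
    ultimately show ?thesis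
      by (simp only: nat_int)
  qed
qed

text \<open>Deleting the bag, a cut set, leaves two vertices not joined by a walk, hence distinct.
  In a one-vertex graph every node is therefore a leaf.\<close>

lemma non_leaf_not_singleton:
  assumes "x \<in> verts X" "children x \<noteq> {}"
  obtains u v where "u \<in> verts G" "v \<in> verts G" "u \<noteq> v"
proof -
  let ?H = "G \<restriction> subtree_verts C x"
  let ?D = "?H \<restriction> (verts ?H - C x)"
  have "cut_set ?H (C x)"
    using bag_cut_set assms by (auto simp: is_leaf_def)
  then have "verts ?D \<noteq> {}" "\<not> Digraph_Component.connected ?D"
    by (auto simp: cut_set_def)
  then obtain u v where uv: "u \<in> verts ?D" "v \<in> verts ?D" "\<not> u \<rightarrow>\<^sup>*\<^bsub>mk_symmetric ?D\<^esub> v"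
    by (auto simp: Digraph_Component.connected_def strongly_connected_def)
  then have "u \<noteq> v"
    by (auto simp: reachable_def)
  with uv that subtree_verts_subset show ?thesis
    by auto
qed

end

theorem theorem7:
  fixes G :: "('a, 'b) pre_digraph" and X :: "('x, 'y) pre_digraph"
    and r x :: 'x and C :: "'x \<Rightarrow> 'a set"
  assumes "graph G" and "Digraph_Component.connected G"
    and "cut_decomposition G X r C"
    and "x \<in> verts X"
  shows "pre_digraph.zombies_capture G
           (rooted_tree.load X C x) (rooted_tree.subtree_verts X C x) (rooted_tree.time X G C x)"
proof -
  interpret G: graph G
    by (rule assms(1))
  interpret cut_decomposition G X r C
    by (rule assms(3))
  have sc: "strongly_connected G"
    using G.symmetric_connected_imp_strongly_connected assms(2) by blast
  show ?thesis
  proof (cases "1 \<le> G.diam")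
    case True
    show ?thesis
      using time_pos[OF True, of C x] capturable_subtree[OF assms(1) sc True assms(4)]
      by (intro G.zombies_capture_if_capturable) auto
  next
    \<comment> \<open>Diameter 0 leaves a single vertex, where \<open>time\<close> can be 0, so that
      the capture must hold initially. It does: some zombie starts on the survivor's vertex.\<close>
    case False
    have single: "u = v" if "u \<in> verts G" "v \<in> verts G" for u v
      using G.gdist_eq_0D[of u v] G.gdist_le_diam[OF that] sc that False by auto
    then have leaf: "children x = {}"
      using non_leaf_not_singleton[OF assms(4)] by metis
    have bag: "subtree_verts C x = C x"
      using subtree_verts_eq[OF assms(4)] leaf by simp
    have "card (C x) \<le> 1"
      using single bag_subset[OF assms(4)] by (metis One_nat_def card_le_Suc0_iff_eq
          G.finite_verts finite_subset subsetD)
    then have "0 \<le> time G C x"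
      using leaf False by (simp add: time.simps not_le)
    then show ?thesis
    proof (rule G.zombies_capture_if_capturable)
      fix z s
      assume z: "length z = load C x" "set z \<subseteq> verts G" and s: "s \<in> subtree_verts C x"
      have "finite (C x)"
        using bag_subset[OF assms(4)] by (rule finite_subset) simp
      then have "z \<noteq> []"
        using z(1) s bag leaf by (auto simp: load.simps)
      then have "hd z = s"
        using z(2) s subtree_verts_subset by (intro single) auto
      with \<open>z \<noteq> []\<close> show "G.capturable (nat (time G C x)) (subtree_verts C x) z s"
        by (auto intro: G.capturable_if_in)
    qed
  qed
qed

end
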